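(* Let $p=(v_1,\dots,v_n)$ be a hyperbolic polygon, with angles $\alpha_1,\dots,\alpha_n$, and let $\dot\alpha_1,\dots,\dot\alpha_n\in\mathbb{R}$ be a first-order variation of its angles induced by an isometric first-order deformation of $p$. Then $$\sum_{i=1}^n\dot\alpha_i v_i=0,$$ where the $v_i$ are considered as points of $H^2\subset\mathbb{R}^3_1$. Conversely, if this equation is satisfied by an $n$-tuple $(\dot\alpha_1,\dots,\dot\alpha_n)\in\mathbb{R}^n$ and moreover the $v_i$ are not all on a hyperbolic geodesic, then there exists an isometric first-order deformation of $p$ such that the $\dot\alpha_i$ are the associated first-order variations of the $\alpha_i$.
   Context: $\mathbb{R}^3_1$ is $\mathbb{R}^3$ with the bilinear form $\langle(x,y,z),(x',y',z')\rangle=xx'+yy'-zz'$, and $H^2=\{u=(x,y,z)\in\mathbb{R}^3_1 : \langle u,u\rangle=-1,\ z>0\}$ with the induced metric is the hyperbolic plane. A hyperbolic polygon with $n\ge 3$ vertices is a finite sequence $p=(v_1,\dots,v_n)$ of points of $H^2$ with $v_i\ne v_{i+1}$ for all $i$ (indices modulo $n$). Its edges are the geodesic segments from $v_i$ to $v_{i+1}$. The angle $\alpha_i\in\mathbb{R}/2\pi\mathbb{Z}$ at $v_i$ is the oriented angle in $T_{v_i}H^2$ (for a fixed orientation of $H^2$) from the direction at $v_i$ of the edge towards $v_{i+1}$ to the direction at $v_i$ of the edge towards $v_{i-1}$. A first-order deformation of $p$ is an $n$-tuple $(\dot v_1,\dots,\dot v_n)$ with $\dot v_i\in T_{v_i}H^2$;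 it is isometric if $\langle\dot v_i,v_{i+1}\rangle+\langle v_i,\dot v_{i+1}\rangle=0$ for all $i$ (edge lengths do not change at first order). The induced first-order variation of the angles is the derivative of $(\alpha_1,\dots,\alpha_n)$ in the direction $(\dot v_1,\dots,\dot v_n)$. *)

theory Defs
  imports "HOL-Analysis.Analysis"
begin

definition lor :: "real^3 \<Rightarrow> real^3 \<Rightarrow> real" where
  "lor x y = x$1 * y$1 + x$2 * y$2 - x$3 * y$3"

definition H2 :: "(real^3) set" where
  "H2 = {x. lor x x = -1 \<and> x$3 > 0}"

definition tangent :: "real^3 \<Rightarrow> (real^3) set" where
  "tangent v = {x. lor v x = 0}"

definition unit_tangent :: "real^3 \<Rightarrow> (real^3) set" where
  "unit_tangent v = {u \<in> tangent v. lor u u = 1}"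

text \<open>The unit speed geodesic of \<^const>\<open>H2\<close> starting at \<open>v\<close> with velocity \<open>u \<in> unit_tangent v\<close>.\<close>

definition geod :: "real^3 \<Rightarrow> real^3 \<Rightarrow> real \<Rightarrow> real^3" where
  "geod v u t = cosh t *\<^sub>R v + sinh t *\<^sub>R u"

definition is_geodesic :: "(real^3) set \<Rightarrow> bool" where
  "is_geodesic g \<longleftrightarrow> (\<exists>v\<in>H2. \<exists>u\<in>unit_tangent v. g = range (geod v u))"

text \<open>The direction at \<open>v\<close> of the geodesic segment from \<open>v\<close> to \<open>w\<close>, for distinct points
  \<open>v\<close>, \<open>w\<close> of \<^const>\<open>H2\<close>. Existence and uniqueness are shown in \<open>direction_eqI\<close> and \<open>direction\<close>.\<close>

definition direction :: "real^3 \<Rightarrow> real^3 \<Rightarrow> real^3" where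
  "direction v w = (THE u. u \<in> unit_tangent v \<and> (\<exists>d>0. geod v u d = w))"

text \<open>The parameter \<open>\<sigma> \<in> {1, -1}\<close> selects one of the two orientations of \<^const>\<open>H2\<close>, and
  \<open>quarter_turn \<sigma> v\<close> is the rotation of \<open>tangent v\<close> by the angle \<open>pi / 2\<close> for that orientation.
  Up to the sign \<open>\<sigma>\<close> it is the Lorentzian cross product with \<open>v\<close>, that is
  \<open>lor (quarter_turn 1 v u) z = det (v, u, z)\<close> for all \<open>z\<close>; at \<open>(0, 0, 1)\<close> it maps
  \<open>(1, 0, 0)\<close> to \<open>(0, \<sigma>, 0)\<close>.\<close>

definition quarter_turn :: "real \<Rightarrow> real^3 \<Rightarrow> real^3 \<Rightarrow> real^3" where
  "quarter_turn \<sigma> v u = (let c = cross3 v u in \<sigma> *\<^sub>R vector [c$1, c$2, - c$3])"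

text \<open>An element of the quotient of the reals by \<open>2 * pi\<close> times the integers is represented by its
  coset, the set of all its real representatives (see \<open>oriented_angle_coset\<close>).\<close>

definition oriented_angle :: "real \<Rightarrow> real^3 \<Rightarrow> real^3 \<Rightarrow> real^3 \<Rightarrow> real set" where
  "oriented_angle \<sigma> v u w = {\<theta>. w = cos \<theta> *\<^sub>R u + sin \<theta> *\<^sub>R quarter_turn \<sigma> v u}"

text \<open>The vertices are \<open>v 0, \<dots>, v (n - 1)\<close>, with indices modulo \<open>n\<close>; the values of \<open>v\<close> at other
  indices are irrelevant.\<close>

definition nxt :: "nat \<Rightarrow> nat \<Rightarrow> nat" where
  "nxt n i = (i + 1) mod n"

definition prv :: "nat \<Rightarrow> nat \<Rightarrow> nat" where
  "prv n i = (i + n - 1) mod n"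

definition hyperbolic_polygon :: "nat \<Rightarrow> (nat \<Rightarrow> real^3) \<Rightarrow> bool" where
  "hyperbolic_polygon n v \<longleftrightarrow> n \<ge> 3 \<and> (\<forall>i<n. v i \<in> H2) \<and> (\<forall>i<n. v i \<noteq> v (nxt n i))"

definition vertex_angle :: "real \<Rightarrow> nat \<Rightarrow> (nat \<Rightarrow> real^3) \<Rightarrow> nat \<Rightarrow> real set" where
  "vertex_angle \<sigma> n v i =
     oriented_angle \<sigma> (v i) (direction (v i) (v (nxt n i))) (direction (v i) (v (prv n i)))"

definition deformation :: "nat \<Rightarrow> (nat \<Rightarrow> real^3) \<Rightarrow> (nat \<Rightarrow> real^3) \<Rightarrow> bool" where
  "deformation n v v' \<longleftrightarrow> (\<forall>i<n. v' i \<in> tangent (v i))"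

definition isometric_deformation :: "nat \<Rightarrow> (nat \<Rightarrow> real^3) \<Rightarrow> (nat \<Rightarrow> real^3) \<Rightarrow> bool" where
  "isometric_deformation n v v' \<longleftrightarrow> deformation n v v' \<and>
     (\<forall>i<n. lor (v' i) (v (nxt n i)) + lor (v i) (v' (nxt n i)) = 0)"

definition deformation_path ::
    "nat \<Rightarrow> (nat \<Rightarrow> real^3) \<Rightarrow> (nat \<Rightarrow> real^3) \<Rightarrow> (real \<Rightarrow> nat \<Rightarrow> real^3) \<Rightarrow> bool" where
  "deformation_path n v v' c \<longleftrightarrow> (\<forall>i<n. (\<forall>t. c t i \<in> H2) \<and> c 0 i = v i \<and>
     ((\<lambda>t. c t i) has_vector_derivative v' i) (at 0))"

text \<open>The numbers \<open>\<alpha>' i\<close> are the derivatives of the angles, which are differentiable functions of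
  the vertices, in the direction \<open>v'\<close>: along every path of tuples of points of \<^const>\<open>H2\<close> with initial
  velocity \<open>v'\<close>, real lifts of the angles have derivatives \<open>\<alpha>' i\<close> at \<open>0\<close>. By
  \<open>deformation_path_exists\<close> there always is such a path, and the derivatives do not depend on it.\<close>

definition angle_variation ::
    "real \<Rightarrow> nat \<Rightarrow> (nat \<Rightarrow> real^3) \<Rightarrow> (nat \<Rightarrow> real^3) \<Rightarrow> (nat \<Rightarrow> real) \<Rightarrow> bool" where
  "angle_variation \<sigma> n v v' \<alpha>' \<longleftrightarrow> (\<forall>c. deformation_path n v v' c \<longrightarrow>
     (\<forall>i<n. \<exists>\<theta>. (\<forall>\<^sub>F t in nhds 0. \<theta> t \<in> vertex_angle \<sigma> n (c t) i) \<and>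
        (\<theta> has_real_derivative \<alpha>' i) (at 0)))"

lemma lor_H2_less:
  assumes "x \<in> H2" "y \<in> H2" "x \<noteq> y"
  shows "lor x y < -1"
proof -
  define a b c d e f where "a = x$1" and "b = x$2" and "c = x$3"
    and "d = y$1" and "e = y$2" and "f = y$3"
  note defs = this
  have 1: "c\<^sup>2 = 1 + a\<^sup>2 + b\<^sup>2" "f\<^sup>2 = 1 + d\<^sup>2 + e\<^sup>2" "c > 0" "f > 0"
    using assms by (auto simp: H2_def lor_def defs power2_eq_square)
  have 2: "a \<noteq> d \<or> b \<noteq> e"
  proof (rule ccontr)
    assume "\<not> ?thesis"
    with 1 have "c\<^sup>2 = f\<^sup>2" by simp
    then have "c = f" using 1(3,4) by simp
    with \<open>\<not> ?thesis\<close> have "x = y" by (simp add: vec_eq_iff forall_3 defs)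
    with assms show False by simp
  qed
  have "(c * f)\<^sup>2 - (1 + a*d + b*e)\<^sup>2 = (a - d)\<^sup>2 + (b - e)\<^sup>2 + (a*e - b*d)\<^sup>2"
    unfolding power_mult_distrib 1 by (simp add: power2_eq_square algebra_simps)
  moreover have "(a - d)\<^sup>2 + (b - e)\<^sup>2 > 0"
    using 2 by (simp add: sum_power2_gt_zero_iff)
  ultimately have "(1 + a*d + b*e)\<^sup>2 < (c * f)\<^sup>2"
    using zero_le_power2[of "a*e - b*d"] by linarith
  then have "1 + a*d + b*e < c * f"
    by (rule power_less_imp_less_base) (use 1(3,4) in simp)
  then show ?thesis by (simp add: lor_def defs)
qed

lemma lor_add_left: "lor (x + y) z = lor x z + lor y z"
  and lor_add_right: "lor z (x + y) = lor z x + lor z y"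
  and lor_diff_left: "lor (x - y) z = lor x z - lor y z"
  and lor_diff_right: "lor z (x - y) = lor z x - lor z y"
  and lor_scale_left: "lor (r *\<^sub>R x) z = r * lor x z"
  and lor_scale_right: "lor z (r *\<^sub>R x) = r * lor z x"
  and lor_commute: "lor x y = lor y x"
  by (simp_all add: lor_def algebra_simps)

lemmas lor_simps = lor_add_left lor_add_right lor_diff_left lor_diff_right
  lor_scale_left lor_scale_right

lemma direction_eqI:
  assumes v: "v \<in> H2" and u: "u \<in> unit_tangent v" and d: "d > 0" "geod v u d = w"
  shows "direction v w = u"
  unfolding direction_def
proof (rule the_equality)
  show "u \<in> unit_tangent v \<and> (\<exists>d>0. geod v u d = w)" using u d by blast
next
  fix u' assume "u' \<in> unit_tangent v \<and> (\<exists>d>0. geod v u' d = w)"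
  then obtain d' where u': "u' \<in> unit_tangent v" and d': "d' > 0" "geod v u' d' = w" by blast
  have "lor v (geod v u d) = - cosh d" "lor v (geod v u' d') = - cosh d'"
    using v u u' by (simp_all add: H2_def unit_tangent_def tangent_def geod_def lor_simps)
  then have "cosh d = cosh d'" using d(2) d'(2) by simp
  then have "d = d'"
    using d(1) d'(1) cosh_real_nonneg_le_iff[of d d'] cosh_real_nonneg_le_iff[of d' d] by simp
  with d d' have "sinh d *\<^sub>R u = sinh d *\<^sub>R u'"
    by (auto simp: geod_def)
  with d show "u' = u" by simp
qed

lemma direction:
  assumes v: "v \<in> H2" and w: "w \<in> H2" and "v \<noteq> w"
  shows "direction v w = (w + lor v w *\<^sub>R v) /\<^sub>R sqrt ((lor v w)\<^sup>2 - 1)" (is "_ = ?u")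
    and "direction v w \<in> unit_tangent v"
    and "\<exists>d>0. geod v (direction v w) d = w"
proof -
  define k where "k = - lor v w"
  have k: "k > 1" using lor_H2_less[OF assms] by (simp add: k_def)
  define d where "d = arcosh k"
  have d: "d > 0" "cosh d = k" using k by (auto simp: d_def)
  have k2: "k\<^sup>2 - 1 > 0" using k one_less_power[of k 2] by simp
  have "(sinh d)\<^sup>2 = k\<^sup>2 - 1" using d by (simp add: sinh_square_eq)
  then have s: "sinh d = sqrt (k\<^sup>2 - 1)"
    using d by (simp flip: \<open>(sinh d)\<^sup>2 = k\<^sup>2 - 1\<close>)
  have u: "?u = (w - k *\<^sub>R v) /\<^sub>R sinh d"
    by (simp add: s k_def)
  have sd: "sinh d > 0" using d by simp
  have "lor v ?u = 0"
    unfolding u using v by (simp add: lor_simps k_def H2_def)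
  moreover have "lor ?u ?u = 1"
  proof -
    have "lor (w - k *\<^sub>R v) (w - k *\<^sub>R v) = k\<^sup>2 - 1"
      using v w by (simp add: lor_simps k_def H2_def lor_commute[of w v] power2_eq_square)
    also have "\<dots> = (sinh d)\<^sup>2" using \<open>(sinh d)\<^sup>2 = k\<^sup>2 - 1\<close> by simp
    finally show ?thesis
      unfolding u lor_scale_left lor_scale_right using sd
      by (simp add: power2_eq_square field_simps)
  qed
  ultimately have ut: "?u \<in> unit_tangent v" by (simp add: unit_tangent_def tangent_def)
  have g: "geod v ?u d = w"
    unfolding geod_def u using sd d by simp
  show eq: "direction v w = ?u" using direction_eqI[OF v ut d(1) g] .
  show "direction v w \<in> unit_tangent v" using ut eq by simp
  show "\<exists>d>0. geod v (direction v w) d = w" using g d eq by metis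
qed

lemma quarter_turn:
  assumes "v \<in> H2" "u \<in> unit_tangent v" "\<sigma> \<in> {1, -1}"
  shows "quarter_turn \<sigma> v u \<in> unit_tangent v" and "lor u (quarter_turn \<sigma> v u) = 0"
    and "lor (quarter_turn \<sigma> v u) z = \<sigma> * det (vector [v, u, z])"
proof -
  have *: "lor (quarter_turn \<sigma> v u) z = \<sigma> * det (vector [v, u, z])" for z
    by (simp add: lor_def quarter_turn_def Let_def cross3_def det_3 algebra_simps)
  then show "lor (quarter_turn \<sigma> v u) z = \<sigma> * det (vector [v, u, z])" .
  show "lor u (quarter_turn \<sigma> v u) = 0"
    unfolding lor_commute[of u] * by (simp add: det_3)
  have "lor v (quarter_turn \<sigma> v u) = 0"
    unfolding lor_commute[of v] * by (simp add: det_3)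
  moreover have "lor (quarter_turn \<sigma> v u) (quarter_turn \<sigma> v u)
      = \<sigma>\<^sup>2 * ((lor v u)\<^sup>2 - lor v v * lor u u)"
    by (simp add: lor_def quarter_turn_def Let_def cross3_def power2_eq_square algebra_simps)
  ultimately show "quarter_turn \<sigma> v u \<in> unit_tangent v"
    using assms by (auto simp: unit_tangent_def tangent_def H2_def)
qed

lemma tangent_expansion:
  assumes v: "v \<in> H2" and u: "u \<in> unit_tangent v" and s: "\<sigma> \<in> {1, -1}" and w: "w \<in> tangent v"
  shows "w = lor u w *\<^sub>R u + lor (quarter_turn \<sigma> v u) w *\<^sub>R quarter_turn \<sigma> v u"
proof -
  let ?J = "quarter_turn \<sigma> v u"
  define x where "x = w - lor u w *\<^sub>R u - lor ?J w *\<^sub>R ?J"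
  note J = quarter_turn[OF v u s]
  have o: "lor x v = 0" "lor x u = 0" "lor x ?J = 0"
    using J(1,2) u w
    by (simp_all add: x_def lor_simps unit_tangent_def tangent_def lor_commute[of w]
          lor_commute[of u v] lor_commute[of ?J v] lor_commute[of ?J u])
  define M where "M = (vector [v, u, ?J] :: real^3^3)"
  have "\<sigma> * det M = 1"
    using J(1) J(3)[of ?J] by (simp add: M_def unit_tangent_def)
  then have "det M \<noteq> 0" by auto
  define y :: "real^3" where "y = vector [x$1, x$2, - x$3]"
  have "M *v y = 0"
    using o by (simp add: M_def y_def vec_eq_iff forall_3 matrix_vector_mult_def sum_3 lor_def algebra_simps)
  with \<open>det M \<noteq> 0\<close> have "y = 0"
    using invertible_det_nz[of M] invertible_left_inverse[of M] matrix_left_invertible_ker[of M] by blast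
  then have "x = 0"
    by (simp add: y_def vec_eq_iff forall_3)
  then show ?thesis by (simp add: x_def algebra_simps)
qed

lemma oriented_angle_coset:
  assumes v: "v \<in> H2" and u: "u \<in> unit_tangent v" and s: "\<sigma> \<in> {1, -1}" and w: "w \<in> unit_tangent v"
  shows "\<exists>\<theta>. oriented_angle \<sigma> v u w = {\<theta> + 2 * pi * of_int k | k. True}"
proof -
  let ?J = "quarter_turn \<sigma> v u"
  define a b where "a = lor u w" and "b = lor ?J w"
  note J = quarter_turn[OF v u s]
  have J': "lor ?J ?J = 1" "lor u u = 1" "lor ?J u = 0"
    using J(1) J(2) u by (simp_all add: unit_tangent_def lor_commute[of ?J u])
  have e: "w = a *\<^sub>R u + b *\<^sub>R ?J"
    using tangent_expansion[OF v u s] w by (simp add: unit_tangent_def a_def b_def)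
  have "lor w w = a\<^sup>2 + b\<^sup>2"
    unfolding e using J' J(2) by (simp add: lor_simps power2_eq_square)
  then have "a\<^sup>2 + b\<^sup>2 = 1" using w by (simp add: unit_tangent_def)
  then obtain \<theta> where t: "a = cos \<theta>" "b = sin \<theta>" using sincos_total_2pi by metis
  have "\<phi> \<in> oriented_angle \<sigma> v u w \<longleftrightarrow> cos \<phi> = cos \<theta> \<and> sin \<phi> = sin \<theta>" for \<phi>
  proof
    assume "\<phi> \<in> oriented_angle \<sigma> v u w"
    then have w2: "w = cos \<phi> *\<^sub>R u + sin \<phi> *\<^sub>R ?J" by (simp add: oriented_angle_def)
    have "a = cos \<phi>" unfolding a_def by (subst w2) (use J' J(2) in \<open>simp add: lor_simps\<close>)
    moreover have "b = sin \<phi>" unfolding b_def by (subst w2) (use J' J(2) in \<open>simp add: lor_simps\<close>)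
    ultimately show "cos \<phi> = cos \<theta> \<and> sin \<phi> = sin \<theta>" using t by simp
  qed (use e t in \<open>simp add: oriented_angle_def\<close>)
  then have "\<phi> \<in> oriented_angle \<sigma> v u w \<longleftrightarrow> (\<exists>k::int. \<phi> = \<theta> + 2 * pi * of_int k)" for \<phi>
    using sin_cos_eq_iff[of \<phi> \<theta>] by auto
  then show ?thesis by blast
qed

lemma deformation_path_exists:
  assumes v: "\<forall>i<n. v i \<in> H2" and d: "deformation n v v'"
  shows "\<exists>c. deformation_path n v v' c"
proof -
  define r where "r x y = sqrt (1 + x\<^sup>2 + y\<^sup>2)" for x y :: real
  define p where "p x y z = x *\<^sub>R axis 1 1 + y *\<^sub>R axis 2 1 + z *\<^sub>R axis (3::3) (1::real)"
    for x y z :: real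
  have p: "p x y z $ 1 = x" "p x y z $ 2 = y" "p x y z $ 3 = z" for x y z
    by (simp_all add: p_def axis_def)
  define c where "c t i = (let x = v i $ 1 + t * v' i $ 1; y = v i $ 2 + t * v' i $ 2
    in p x y (r x y))" for t i
  have pos: "1 + x\<^sup>2 + y\<^sup>2 > 0" for x y :: real
    by (simp add: add_pos_nonneg)
  have "c t i \<in> H2" for t i
    using pos by (simp add: H2_def lor_def c_def Let_def p r_def power2_eq_square)
  moreover have c0: "c 0 i = v i" and "((\<lambda>t. c t i) has_vector_derivative v' i) (at 0)" if "i < n" for i
  proof -
    define x y z x' y' z' where "x = v i $ 1" and "y = v i $ 2" and "z = v i $ 3"
      and "x' = v' i $ 1" and "y' = v' i $ 2" and "z' = v' i $ 3"
    note defs = this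
    have "v i \<in> H2" "v' i \<in> tangent (v i)" using v d that by (auto simp: deformation_def)
    then have z: "z > 0" "1 + x\<^sup>2 + y\<^sup>2 = z\<^sup>2" and z': "x * x' + y * y' = z * z'"
      by (auto simp: H2_def tangent_def lor_def defs power2_eq_square)
    have rz: "r x y = z" using z by (simp add: r_def)
    then show "c 0 i = v i"
      by (simp add: c_def vec_eq_iff forall_3 p defs)
    have "((\<lambda>t. r (x + t * x') (y + t * y')) has_real_derivative
        (2 * x * x' + 2 * y * y') / (2 * z)) (at 0)"
      unfolding r_def using pos[of x y] z
      by (auto intro!: derivative_eq_intros simp: field_simps)
    moreover have "(2 * x * x' + 2 * y * y') / (2 * z) = z'"
      using z' z(1) by (simp add: field_simps)
    ultimately have 3: "((\<lambda>t. r (x + t * x') (y + t * y')) has_real_derivative z') (at 0)" by simp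
    have 1: "((\<lambda>t. x + t * x') has_real_derivative x') (at 0)"
        "((\<lambda>t. y + t * y') has_real_derivative y') (at 0)"
      by (auto intro!: derivative_eq_intros)
    have "v' i = p x' y' z'" by (simp add: vec_eq_iff forall_3 p defs)
    moreover have "((\<lambda>t. p (x + t * x') (y + t * y') (r (x + t * x') (y + t * y')))
        has_vector_derivative p x' y' z') (at 0)"
      unfolding p_def
      using 1 3 by (intro has_vector_derivative_add has_vector_derivative_scaleR[where g'=0, simplified] has_vector_derivative_const)
    ultimately show "((\<lambda>t. c t i) has_vector_derivative v' i) (at 0)"
      by (simp add: c_def Let_def defs)
  qed
  ultimately have "deformation_path n v v' c" by (simp add: deformation_path_def)
  then show ?thesis by blast
qed

end

theory Submission
  imports Defs
begin

text \<open>An isometric deformation moves each edge rigidly to first order: there is a Killing field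
  \<open>x \<mapsto> Y\<^sub>i \<times> x\<close>, with \<open>\<times>\<close> the Lorentzian cross product, which induces the given
  velocities at both ends of the edge from \<open>v\<^sub>i\<close> to \<open>v\<^sub>i\<^sub>+\<^sub>1\<close>. At \<open>v\<^sub>i\<close> the fields of the two
  adjacent edges agree, so \<open>Y\<^sub>i - Y\<^sub>i\<^sub>-\<^sub>1\<close> is a multiple of \<open>v\<^sub>i\<close>; it is the infinitesimal rotation
  about \<open>v\<^sub>i\<close> by which one edge turns relative to the other, so that the factor is
  \<open>\<plusminus>\<alpha>'\<^sub>i\<close>. Summing over the polygon gives the equation, and conversely the equation says that
  the partial sums of \<open>\<alpha>'\<^sub>i v\<^sub>i\<close> define such a closed family of Killing fields.\<close>

section \<open>Algebra of the Lorentzian cross product\<close>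

definition lcross :: "real^3 \<Rightarrow> real^3 \<Rightarrow> real^3" where
  "lcross x y = quarter_turn 1 x y"

lemma lcross_nth:
  "lcross x y $ 1 = x$2 * y$3 - x$3 * y$2"
  "lcross x y $ 2 = x$3 * y$1 - x$1 * y$3"
  "lcross x y $ 3 = x$2 * y$1 - x$1 * y$2"
  by (simp_all add: lcross_def quarter_turn_def cross3_def Let_def)

lemma quarter_turn_eq_lcross: "quarter_turn \<sigma> x y = \<sigma> *\<^sub>R lcross x y"
  by (simp add: lcross_def quarter_turn_def Let_def)

lemma lcross_simps:
  "lcross (x + y) z = lcross x z + lcross y z" "lcross z (x + y) = lcross z x + lcross z y"
  "lcross (x - y) z = lcross x z - lcross y z" "lcross z (x - y) = lcross z x - lcross z y"
  "lcross (r *\<^sub>R x) z = r *\<^sub>R lcross x z" "lcross z (r *\<^sub>R x) = r *\<^sub>R lcross z x"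
  "lcross x x = 0"
  by (simp_all add: vec_eq_iff forall_3 lcross_nth algebra_simps)

lemma lcross_anticommute: "lcross y x = - lcross x y"
  by (simp add: vec_eq_iff forall_3 lcross_nth algebra_simps)

lemma lor_lcross_same: "lor (lcross x y) x = 0" "lor (lcross x y) y = 0"
  by (simp_all add: lor_def lcross_nth algebra_simps)

text \<open>Both sides are determinants, with two arguments exchanged. Equivalently, the linear map
  \<open>lcross x\<close> is skew for \<open>lor\<close>, so its flow consists of
  isometries.\<close>

lemma lor_lcross_swap: "lor (lcross x z) y = - lor (lcross x y) z"
  by (simp add: lor_def lcross_nth algebra_simps)

text \<open>The form has determinant -1, which makes the signs opposite to those of the Euclidean
  triple product.\<close>

lemma lcross_lcross_right: "lcross x (lcross y z) = lor x y *\<^sub>R z - lor x z *\<^sub>R y"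
  by (simp add: vec_eq_iff forall_3 lcross_nth lor_def algebra_simps)

lemma lor_lcross_lcross:
  "lor (lcross w x) (lcross y z) = lor w z * lor x y - lor w y * lor x z"
  by (simp add: lcross_nth lor_def algebra_simps)

text \<open>The map \<open>lcross w\<close> is skew, hence has trace 0, and so preserves
  determinants to first order.\<close>

lemma lor_lcross_derivation:
  "lor (lcross (lcross w x) y) z + lor (lcross x (lcross w y)) z + lor (lcross x y) (lcross w z) = 0"
  by (simp add: lcross_nth lor_def algebra_simps)

text \<open>The squared determinant of three vectors is minus their Gram determinant. For points of
  \<open>H2\<close> this is the relation between cosine and sine of the angle at \<open>x\<close>,
  with denominators cleared.\<close>

lemma lor_lcross_square:
  assumes "lor x x = -1" "lor y y = -1" "lor z z = -1"
  shows "(lor y z + lor x y * lor x z)\<^sup>2 + (lor (lcross x y) z)\<^sup>2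
    = ((lor x y)\<^sup>2 - 1) * ((lor x z)\<^sup>2 - 1)"
proof -
  have "(lor (lcross x y) z)\<^sup>2 = lor x x * (lor y z)\<^sup>2 + lor y y * (lor x z)\<^sup>2
      + lor z z * (lor x y)\<^sup>2 - lor x x * lor y y * lor z z - 2 * lor x y * lor y z * lor x z"
    by (simp add: lcross_nth lor_def power2_eq_square algebra_simps)
  then show ?thesis
    unfolding assms by (simp add: power2_eq_square algebra_simps)
qed

section \<open>Killing fields along an edge\<close>

text \<open>The Killing fields vanishing at \<open>x\<close> are the rotations about
  \<open>x\<close>: applying \<open>lcross x\<close> again recovers \<open>y\<close> by the triple
  product, because \<open>lor x x = -1\<close>.\<close>

lemma lcross_eq_0_H2D:
  assumes "x \<in> H2" "lcross y x = 0"
  shows "y = - lor x y *\<^sub>R x"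
proof -
  have "lcross x y = 0" using assms(2) lcross_anticommute[of x y] by simp
  then have "lcross x (lcross x y) = 0" by (simp add: vec_eq_iff forall_3 lcross_nth)
  then have "- y = lor x y *\<^sub>R x"
    using assms(1) by (simp add: lcross_lcross_right H2_def)
  then have "- (- y) = - (lor x y *\<^sub>R x)" by simp
  then show ?thesis by simp
qed

text \<open>The normal \<open>lcross x y\<close> has positive square
  \<open>(lor x y)\<^sup>2 - 1\<close>, and the triple product shows that \<open>w\<close> is
  parallel to it.\<close>

lemma orthogonal_eq_scale_lcross:
  assumes xy: "x \<in> H2" "y \<in> H2" "x \<noteq> y" and w: "lor w x = 0" "lor w y = 0"
  shows "\<exists>t. w = t *\<^sub>R lcross x y"
proof -
  let ?N = "lcross x y"
  have "lor x y < -1" using lor_H2_less[OF xy] .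
  then have "(lor x y)\<^sup>2 > 1" using one_less_power[of "- lor x y" 2] by simp
  then have N: "lor ?N ?N \<noteq> 0"
    using xy by (simp add: lor_lcross_lcross H2_def lor_commute[of y x] power2_eq_square)
  have "lcross w ?N = 0" using w by (simp add: lcross_lcross_right)
  then have "lcross ?N (lcross w ?N) = 0" by (simp add: vec_eq_iff forall_3 lcross_nth)
  then have "lor ?N ?N *\<^sub>R w = lor ?N w *\<^sub>R ?N" by (simp add: lcross_lcross_right[of ?N w ?N])
  then have "w = (lor ?N w / lor ?N ?N) *\<^sub>R ?N"
    using N by (metis (no_types) divide_inverse mult.commute scaleR_scaleR
        left_inverse scaleR_one)
  then show ?thesis by blast
qed

text \<open>The field of \<open>lcross x x'\<close> has the right velocity at \<open>x\<close>.
  Adding a rotation about \<open>x\<close> keeps this and corrects the velocity at \<open>y\<close>,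
  where the error is normal to the plane of the edge.\<close>

lemma edge_Killing_field_exists:
  assumes xy: "x \<in> H2" "y \<in> H2" "x \<noteq> y"
    and tan: "x' \<in> tangent x" "y' \<in> tangent y"
    and iso: "lor x' y + lor x y' = 0"
  shows "\<exists>Y. lcross Y x = x' \<and> lcross Y y = y'"
proof -
  have l: "lor x x = -1" "lor x x' = 0" "lor y y' = 0"
    using xy tan by (simp_all add: H2_def tangent_def)
  \<comment> \<open>This is the error at \<open>y\<close> of the field of
    \<open>lcross x x'\<close>. It is orthogonal to \<open>x\<close> by \<open>iso\<close>, and to
    \<open>y\<close> because \<open>y'\<close> is tangent there.\<close>
  define w where "w = y' + lor x y *\<^sub>R x' - lor y x' *\<^sub>R x"
  have "lor w x = 0" "lor w y = 0"
    using l iso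
    by (simp_all add: w_def lor_simps lor_commute[of y' x] lor_commute[of x' x]
        lor_commute[of y' y] lor_commute[of x' y])
  then obtain t where t: "w = t *\<^sub>R lcross x y"
    using orthogonal_eq_scale_lcross[OF xy] by blast
  have a: "lcross (lcross x x') z = - (lor z x *\<^sub>R x' - lor z x' *\<^sub>R x)" for z
    by (metis lcross_anticommute lcross_lcross_right)
  let ?Y = "lcross x x' + t *\<^sub>R x"
  have "lcross ?Y x = x'" using l by (simp add: lcross_simps a)
  moreover have "lcross ?Y y = y'"
    using t by (simp add: lcross_simps a w_def lor_commute[of y x] algebra_simps)
  ultimately show ?thesis by blast
qed

section \<open>Cosine and sine of the oriented angle\<close>

lemma oriented_angle_iff:
  assumes v: "v \<in> H2" and u: "u \<in> unit_tangent v" and s: "\<sigma> \<in> {1, -1}"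
    and w: "w \<in> unit_tangent v"
  shows "\<theta> \<in> oriented_angle \<sigma> v u w \<longleftrightarrow> cos \<theta> = lor u w \<and> sin \<theta> = lor (quarter_turn \<sigma> v u) w"
proof
  let ?J = "quarter_turn \<sigma> v u"
  note J = quarter_turn[OF v u s]
  assume "\<theta> \<in> oriented_angle \<sigma> v u w"
  then have "w = cos \<theta> *\<^sub>R u + sin \<theta> *\<^sub>R ?J" by (simp add: oriented_angle_def)
  then show "cos \<theta> = lor u w \<and> sin \<theta> = lor ?J w"
    using J(1,2) u by (simp add: lor_simps unit_tangent_def lor_commute[of ?J u])
next
  assume "cos \<theta> = lor u w \<and> sin \<theta> = lor (quarter_turn \<sigma> v u) w"
  then show "\<theta> \<in> oriented_angle \<sigma> v u w"
    using tangent_expansion[OF v u s, of w] w by (simp add: oriented_angle_def unit_tangent_def)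
qed

text \<open>As \<open>lor\<close> is minus the hyperbolic cosine of the distance, this is the
  hyperbolic law of cosines solved for the angle at \<open>x\<close>; the square roots are the
  hyperbolic sines of the adjacent sides.\<close>

definition angle_cos :: "real^3 \<Rightarrow> real^3 \<Rightarrow> real^3 \<Rightarrow> real" where
  "angle_cos x y z = (lor y z + lor x y * lor x z) / (sqrt ((lor x y)\<^sup>2 - 1) * sqrt ((lor x z)\<^sup>2 - 1))"

text \<open>The numerator is the determinant of \<open>x\<close>, \<open>y\<close>,
  \<open>z\<close>; the sign is the one for the orientation \<sigma> = 1.\<close>

definition angle_sin :: "real^3 \<Rightarrow> real^3 \<Rightarrow> real^3 \<Rightarrow> real" where
  "angle_sin x y z = lor (lcross x y) z / (sqrt ((lor x y)\<^sup>2 - 1) * sqrt ((lor x z)\<^sup>2 - 1))"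

text \<open>Each direction is the normalized tangential part of its end point. This replaces
  \<open>direction\<close> by expressions that can be differentiated along paths.\<close>

lemma oriented_angle_direction_iff:
  assumes x: "x \<in> H2" and y: "y \<in> H2" "x \<noteq> y" and z: "z \<in> H2" "x \<noteq> z" and s: "\<sigma> \<in> {1, -1}"
  shows "\<theta> \<in> oriented_angle \<sigma> x (direction x y) (direction x z)
    \<longleftrightarrow> cos \<theta> = angle_cos x y z \<and> sin \<theta> = \<sigma> * angle_sin x y z"
proof -
  have l: "lor x x = -1" using x by (simp add: H2_def)
  note dy = direction[OF x y] and dz = direction[OF x z]
  have "lor (direction x y) (direction x z) = angle_cos x y z"
    unfolding dy(1) dz(1) angle_cos_def
    by (simp add: lor_simps l lor_commute[of y x] divide_simps)
  moreover have "lor (quarter_turn \<sigma> x (direction x y)) (direction x z) = \<sigma> * angle_sin x y z"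
    unfolding dy(1) dz(1) angle_sin_def quarter_turn_eq_lcross
    by (simp add: lor_simps lcross_simps lor_lcross_same divide_simps)
  ultimately show ?thesis
    using oriented_angle_iff[OF x dy(2) s dz(2)] by simp
qed

lemma lor_H2_square_gt:
  assumes "x \<in> H2" "y \<in> H2" "x \<noteq> y"
  shows "(lor x y)\<^sup>2 - 1 > 0"
  using lor_H2_less[OF assms] one_less_power[of "- lor x y" 2] by simp

lemma angle_cos_sin_square:
  assumes "x \<in> H2" "y \<in> H2" "x \<noteq> y" "z \<in> H2" "x \<noteq> z"
  shows "(angle_cos x y z)\<^sup>2 + (angle_sin x y z)\<^sup>2 = 1"
proof -
  have "(lor x y)\<^sup>2 - 1 > 0" "(lor x z)\<^sup>2 - 1 > 0"
    using lor_H2_square_gt assms by blast+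
  then show ?thesis
    using lor_lcross_square[of x y z] assms
    by (simp add: angle_cos_def angle_sin_def power_divide power_mult_distrib H2_def
        flip: add_divide_distrib)
qed

section \<open>First variation of the angle at a vertex\<close>

text \<open>Differentiating cosine and sine of a lift determines its derivative. The converse
  constructs a lift, since \<open>angle_variation\<close> demands that one exists.\<close>

lemma angle_lift_derivative_iff:
  fixes a b :: "real \<Rightarrow> real"
  assumes da: "(a has_real_derivative a') (at 0)" and db: "(b has_real_derivative b') (at 0)"
    and ev: "\<forall>\<^sub>F t in nhds 0. (a t)\<^sup>2 + (b t)\<^sup>2 = 1"
  shows "(\<exists>\<theta>. (\<forall>\<^sub>F t in nhds 0. cos (\<theta> t) = a t \<and> sin (\<theta> t) = b t) \<and>
      (\<theta> has_real_derivative \<alpha>) (at 0)) \<longleftrightarrow> \<alpha> = a 0 * b' - b 0 * a'"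
proof
  assume "\<exists>\<theta>. (\<forall>\<^sub>F t in nhds 0. cos (\<theta> t) = a t \<and> sin (\<theta> t) = b t) \<and>
      (\<theta> has_real_derivative \<alpha>) (at 0)"
  then obtain \<theta> where c: "\<forall>\<^sub>F t in nhds 0. cos (\<theta> t) = a t" and s: "\<forall>\<^sub>F t in nhds 0. sin (\<theta> t) = b t"
    and d: "(\<theta> has_real_derivative \<alpha>) (at 0)" by (auto simp: eventually_conj_iff)
  have "((\<lambda>t. cos (\<theta> t)) has_real_derivative - sin (\<theta> 0) * \<alpha>) (at 0)"
    using d by (auto intro!: derivative_eq_intros)
  then have "(a has_real_derivative - sin (\<theta> 0) * \<alpha>) (at 0)"
    using DERIV_cong_ev[OF refl c refl] by blast
  then have a': "a' = - sin (\<theta> 0) * \<alpha>" using da DERIV_unique by blast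
  have "((\<lambda>t. sin (\<theta> t)) has_real_derivative cos (\<theta> 0) * \<alpha>) (at 0)"
    using d by (auto intro!: derivative_eq_intros)
  then have "(b has_real_derivative cos (\<theta> 0) * \<alpha>) (at 0)"
    using DERIV_cong_ev[OF refl s refl] by blast
  then have b': "b' = cos (\<theta> 0) * \<alpha>" using db DERIV_unique by blast
  have "a 0 * b' - b 0 * a' = ((cos (\<theta> 0))\<^sup>2 + (sin (\<theta> 0))\<^sup>2) * \<alpha>"
    using eventually_nhds_x_imp_x[OF c] eventually_nhds_x_imp_x[OF s]
    by (simp add: a' b' power2_eq_square algebra_simps del: sin_cos_squared_add sin_cos_squared_add2)
  then show "\<alpha> = a 0 * b' - b 0 * a'" by simp
next
  assume \<alpha>: "\<alpha> = a 0 * b' - b 0 * a'"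
  have ab0: "(a 0)\<^sup>2 + (b 0)\<^sup>2 = 1" using eventually_nhds_x_imp_x[OF ev] .
  then obtain \<theta>0 where \<theta>0: "a 0 = cos \<theta>0" "b 0 = sin \<theta>0" using sincos_total_2pi by metis
  \<comment> \<open>\<open>X + i Y\<close> is \<open>a + i b\<close> divided by its value at 0, a
    unit complex number. It starts at 1, so near 0 it stays in the right half plane, where
    \<open>arctan (Y t / X t)\<close> is its argument.\<close>
  define X Y where "X t = a t * a 0 + b t * b 0" and "Y t = b t * a 0 - a t * b 0" for t
  define \<theta> where "\<theta> t = \<theta>0 + arctan (Y t / X t)" for t
  have X0: "X 0 = 1" and Y0: "Y 0 = 0"
    using ab0 by (simp_all add: X_def Y_def power2_eq_square)
  have dX: "(X has_real_derivative a' * a 0 + b' * b 0) (at 0)"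
    and dY: "(Y has_real_derivative b' * a 0 - a' * b 0) (at 0)"
    unfolding X_def Y_def using da db by (auto intro!: derivative_eq_intros)
  have "(\<theta> has_real_derivative \<alpha>) (at 0)"
    unfolding \<theta>_def using dX dY X0 Y0 \<alpha> by (auto intro!: derivative_eq_intros)
  moreover have "\<forall>\<^sub>F t in nhds 0. cos (\<theta> t) = a t \<and> sin (\<theta> t) = b t"
  proof -
    have "(X \<longlongrightarrow> X 0) (nhds 0)"
      using DERIV_isCont[OF dX] by (simp add: isCont_def tendsto_at_iff_tendsto_nhds)
    then have "\<forall>\<^sub>F t in nhds 0. X t > 0"
      by (rule order_tendstoD) (simp add: X0)
    with ev show ?thesis
    proof eventually_elim
      case (elim t)
      have "(X t)\<^sup>2 + (Y t)\<^sup>2 = ((a t)\<^sup>2 + (b t)\<^sup>2) * ((a 0)\<^sup>2 + (b 0)\<^sup>2)"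
        by (simp add: X_def Y_def power2_eq_square algebra_simps)
      then have XY: "(X t)\<^sup>2 + (Y t)\<^sup>2 = 1" using ab0 elim by simp
      have "1 + (Y t / X t)\<^sup>2 = ((X t)\<^sup>2 + (Y t)\<^sup>2) / (X t)\<^sup>2"
        using elim by (simp add: field_simps)
      then have "sqrt (1 + (Y t / X t)\<^sup>2) = 1 / X t"
        using elim XY by (simp add: real_sqrt_divide)
      then have c: "cos (arctan (Y t / X t)) = X t" and s: "sin (arctan (Y t / X t)) = Y t"
        using elim by (simp_all add: cos_arctan sin_arctan)
      have "cos (\<theta> t) = a 0 * X t - b 0 * Y t" "sin (\<theta> t) = b 0 * X t + a 0 * Y t"
        by (simp_all add: \<theta>_def cos_add sin_add c s \<theta>0)
      moreover have "a 0 * X t - b 0 * Y t = a t * ((a 0)\<^sup>2 + (b 0)\<^sup>2)"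
        "b 0 * X t + a 0 * Y t = b t * ((a 0)\<^sup>2 + (b 0)\<^sup>2)"
        by (simp_all add: X_def Y_def power2_eq_square algebra_simps)
      ultimately show ?case using ab0 by simp
    qed
  qed
  ultimately show "\<exists>\<theta>. (\<forall>\<^sub>F t in nhds 0. cos (\<theta> t) = a t \<and> sin (\<theta> t) = b t) \<and>
      (\<theta> has_real_derivative \<alpha>) (at 0)" by blast
qed

lemma has_vector_derivative_nth:
  assumes "(f has_vector_derivative f') F"
  shows "((\<lambda>t. f t $ i) has_real_derivative (f' $ i)) F"
  using bounded_linear.has_vector_derivative[OF bounded_linear_vec_nth assms]
  by (simp add: has_real_derivative_iff_has_vector_derivative)

lemma lor_has_real_derivative:
  assumes "(f has_vector_derivative f') (at t)" "(g has_vector_derivative g') (at t)"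
  shows "((\<lambda>t. lor (f t) (g t)) has_real_derivative (lor f' (g t) + lor (f t) g')) (at t)"
  unfolding lor_def using assms[THEN has_vector_derivative_nth]
  by (auto intro!: derivative_eq_intros simp: algebra_simps)

lemma lor_lcross_has_real_derivative:
  assumes "(f has_vector_derivative f') (at t)" "(g has_vector_derivative g') (at t)"
    "(h has_vector_derivative h') (at t)"
  shows "((\<lambda>t. lor (lcross (f t) (g t)) (h t)) has_real_derivative
    (lor (lcross f' (g t)) (h t) + lor (lcross (f t) g') (h t) + lor (lcross (f t) (g t)) h')) (at t)"
  unfolding lor_def lcross_nth using assms[THEN has_vector_derivative_nth]
  by (auto intro!: derivative_eq_intros simp: algebra_simps)

text \<open>The formula for \<open>direction\<close> requires distinct points, so along a path the
  angle formulas are available only near the initial parameter.\<close>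

lemma eventually_neq:
  fixes f g :: "real \<Rightarrow> 'a::real_normed_vector"
  assumes "(f has_vector_derivative f') (at t)" "(g has_vector_derivative g') (at t)" "f t \<noteq> g t"
  shows "\<forall>\<^sub>F s in nhds t. f s \<noteq> g s"
proof -
  have "isCont f t" "isCont g t"
    using assms(1,2) has_vector_derivative_continuous by blast+
  then have "((\<lambda>s. f s - g s) \<longlongrightarrow> f t - g t) (nhds t)"
    by (intro tendsto_diff) (simp_all add: isCont_def tendsto_at_iff_tendsto_nhds)
  then have "\<forall>\<^sub>F s in nhds t. f s - g s \<noteq> 0"
    by (rule tendsto_imp_eventually_ne) (use assms(3) in simp)
  then show ?thesis by simp
qed

text \<open>The side \<open>x y\<close> moves by the field \<open>Y\<close> and the side
  \<open>x z\<close> by \<open>Z\<close>. Subtracting the common motion leaves a rotation about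
  \<open>x\<close> with coefficient \<open>k\<close>, which turns the pair of cosine and sine at
  speed \<open>- \<sigma> * k\<close>.\<close>

lemma angle_derivative_iff:
  fixes x y z :: "real \<Rightarrow> real^3"
  assumes H: "\<And>t. x t \<in> H2" "\<And>t. y t \<in> H2" "\<And>t. z t \<in> H2" and ne: "x 0 \<noteq> y 0" "x 0 \<noteq> z 0"
    and s: "\<sigma> \<in> {1, -1}"
    and dx: "(x has_vector_derivative lcross Y (x 0)) (at 0)"
    and dy: "(y has_vector_derivative lcross Y (y 0)) (at 0)"
    and dz: "(z has_vector_derivative lcross Z (z 0)) (at 0)"
    and YZ: "lcross Y (x 0) = lcross Z (x 0)"
  shows "(\<exists>\<theta>. (\<forall>\<^sub>F t in nhds 0. \<theta> t \<in> oriented_angle \<sigma> (x t) (direction (x t) (y t)) (direction (x t) (z t))) \<and>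
      (\<theta> has_real_derivative \<alpha>) (at 0)) \<longleftrightarrow> Y - Z = - (\<sigma> * \<alpha>) *\<^sub>R x 0"
proof -
  define k where "k = - lor (x 0) (Y - Z)"
  have k: "Y - Z = k *\<^sub>R x 0"
    unfolding k_def using YZ by (intro lcross_eq_0_H2D H) (simp add: lcross_simps)
  then have Z: "Z = Y - k *\<^sub>R x 0" by (simp add: algebra_simps)
  define p q r D where "p t = lor (x t) (y t)" and "q t = lor (x t) (z t)" and "r t = lor (y t) (z t)"
    and "D t = lor (lcross (x t) (y t)) (z t)" for t
  \<comment> \<open>Killing fields preserve \<open>lor\<close> to first order, so both adjacent side
    lengths are stationary.\<close>
  have skew: "lor (lcross w u) v + lor u (lcross w v) = 0" for u v w
    using lor_lcross_swap[of w u v] lor_commute[of u "lcross w v"] by simp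
  have dp: "(p has_real_derivative 0) (at 0)" and dq: "(q has_real_derivative 0) (at 0)"
    unfolding p_def q_def
    using lor_has_real_derivative[OF dx dy] lor_has_real_derivative[OF dx dz, unfolded YZ]
    by (simp_all add: skew)
  \<comment> \<open>With \<open>Z\<close> written as \<open>Y - k *\<^sub>R x 0\<close>, the terms
    in \<open>Y\<close> cancel by skewness and only the rotation about \<open>x 0\<close>
    contributes.\<close>
  have "lor (lcross Y (y 0)) (z 0) + lor (y 0) (lcross Z (z 0)) = k * D 0"
    using skew[of Y "y 0" "z 0"] lor_lcross_swap[of "x 0" "z 0" "y 0"]
    by (simp add: Z lcross_simps lor_simps D_def lor_commute[of "y 0" "lcross _ _"])
  then have dr: "(r has_real_derivative k * D 0) (at 0)"
    unfolding r_def using lor_has_real_derivative[OF dy dz] by simp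
  \<comment> \<open>The terms in \<open>Y\<close> cancel again, now by invariance of the
    determinant.\<close>
  have "lor (lcross (lcross Y (x 0)) (y 0)) (z 0) + lor (lcross (x 0) (lcross Y (y 0))) (z 0)
      + lor (lcross (x 0) (y 0)) (lcross Z (z 0)) = - k * (r 0 + p 0 * q 0)"
    using lor_lcross_derivation[of Y "x 0" "y 0" "z 0"] H(1)[of 0]
    by (simp add: Z lcross_simps lor_simps lor_lcross_lcross p_def q_def r_def H2_def
        lor_commute[of "y 0" "x 0"] algebra_simps)
  then have dD: "(D has_real_derivative - k * (r 0 + p 0 * q 0)) (at 0)"
    unfolding D_def using lor_lcross_has_real_derivative[OF dx dy dz] by simp
  define S where "S t = sqrt ((p t)\<^sup>2 - 1) * sqrt ((q t)\<^sup>2 - 1)" for t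
  have pq: "(p 0)\<^sup>2 - 1 > 0" "(q 0)\<^sup>2 - 1 > 0"
    unfolding p_def q_def using lor_H2_square_gt H ne by blast+
  then have S0: "S 0 > 0" by (simp add: S_def)
  have dS: "(S has_real_derivative 0) (at 0)"
    unfolding S_def using dp dq pq by (auto intro!: derivative_eq_intros)
  define a b where "a t = angle_cos (x t) (y t) (z t)" and "b t = \<sigma> * angle_sin (x t) (y t) (z t)" for t
  have a: "a = (\<lambda>t. (r t + p t * q t) / S t)" and b: "b = (\<lambda>t. \<sigma> * D t / S t)"
    by (auto simp: a_def b_def angle_cos_def angle_sin_def p_def q_def r_def S_def D_def)
  have da: "(a has_real_derivative k * D 0 / S 0) (at 0)"
    unfolding a using dr dp dq dS S0 by (auto intro!: derivative_eq_intros)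
  have db: "(b has_real_derivative - (\<sigma> * k * (r 0 + p 0 * q 0) / S 0)) (at 0)"
    unfolding b using dD dS S0 by (auto intro!: derivative_eq_intros simp: field_simps)
  have s2: "\<sigma>\<^sup>2 = 1" using s by auto
  have ev: "\<forall>\<^sub>F t in nhds 0. x t \<noteq> y t \<and> x t \<noteq> z t"
    using eventually_neq[OF dx dy ne(1)] eventually_neq[OF dx dz ne(2)] by (rule eventually_conj)
  have ev1: "\<forall>\<^sub>F t in nhds 0. (a t)\<^sup>2 + (b t)\<^sup>2 = 1"
    using ev by eventually_elim
      (use angle_cos_sin_square H s2 in \<open>auto simp: a_def b_def power_mult_distrib\<close>)
  have "(\<forall>\<^sub>F t in nhds 0. \<theta> t \<in> oriented_angle \<sigma> (x t) (direction (x t) (y t)) (direction (x t) (z t)))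
      \<longleftrightarrow> (\<forall>\<^sub>F t in nhds 0. cos (\<theta> t) = a t \<and> sin (\<theta> t) = b t)" for \<theta>
    by (rule eventually_cong[OF ev])
      (use oriented_angle_direction_iff H s in \<open>auto simp: a_def b_def\<close>)
  then have "?thesis \<longleftrightarrow> (\<alpha> = a 0 * (- (\<sigma> * k * (r 0 + p 0 * q 0) / S 0)) - b 0 * (k * D 0 / S 0)
      \<longleftrightarrow> Y - Z = - (\<sigma> * \<alpha>) *\<^sub>R x 0)"
    using angle_lift_derivative_iff[OF da db ev1, of \<alpha>] by simp
  moreover have "a 0 * (- (\<sigma> * k * (r 0 + p 0 * q 0) / S 0)) - b 0 * (k * D 0 / S 0)
      = - \<sigma> * k * ((a 0)\<^sup>2 + (b 0)\<^sup>2)"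
  proof -
    have "(b 0)\<^sup>2 = (D 0 / S 0)\<^sup>2" using s2 by (simp add: b power_mult_distrib power_divide)
    then show ?thesis by (simp only:) (simp add: a b power2_eq_square field_simps)
  qed
  moreover have "(a 0)\<^sup>2 + (b 0)\<^sup>2 = 1" using eventually_nhds_x_imp_x[OF ev1] .
  moreover have "x 0 \<noteq> 0" using H(1)[of 0] by (auto simp: H2_def lor_def)
  then have "Y - Z = - (\<sigma> * \<alpha>) *\<^sub>R x 0 \<longleftrightarrow> k = - (\<sigma> * \<alpha>)"
    unfolding k scaleR_cancel_right by simp
  then have "Y - Z = - (\<sigma> * \<alpha>) *\<^sub>R x 0 \<longleftrightarrow> \<alpha> = - \<sigma> * k" using s by auto
  ultimately show ?thesis by simp
qed

section \<open>Cyclic indices and all angles of the polygon\<close>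

lemma nxt_less: "i < n \<Longrightarrow> nxt n i < n" and prv_less: "i < n \<Longrightarrow> prv n i < n"
  by (simp_all add: nxt_def prv_def)

lemma prv_eq: "i < n \<Longrightarrow> prv n i = (if i = 0 then n - 1 else i - 1)"
  by (cases i) (auto simp: prv_def)

lemma nxt_prv: "i < n \<Longrightarrow> nxt n (prv n i) = i" and prv_nxt: "i < n \<Longrightarrow> prv n (nxt n i) = i"
  by (auto simp: prv_eq nxt_less) (auto simp: nxt_def mod_Suc split: if_splits)

text \<open>\<open>Y i\<close> belongs to the edge leaving \<open>v i\<close>, hence
  \<open>Y (prv n i)\<close> to the edge arriving there. The criterion at a single vertex applies
  with these two fields, and its right side is independent of the path.\<close>

lemma angle_variation_iff:
  assumes poly: "hyperbolic_polygon n v" and s: "\<sigma> \<in> {1, -1}" and def: "deformation n v v'"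
    and Y: "\<And>i. i < n \<Longrightarrow> lcross (Y i) (v i) = v' i"
      "\<And>i. i < n \<Longrightarrow> lcross (Y i) (v (nxt n i)) = v' (nxt n i)"
  shows "angle_variation \<sigma> n v v' \<alpha>' \<longleftrightarrow> (\<forall>i<n. Y i - Y (prv n i) = - (\<sigma> * \<alpha>' i) *\<^sub>R v i)"
proof -
  have v: "v i \<in> H2" "v i \<noteq> v (nxt n i)" "v i \<noteq> v (prv n i)" if "i < n" for i
    using poly that prv_less[OF that] nxt_prv[OF that] unfolding hyperbolic_polygon_def by metis+
  have *: "(\<exists>\<theta>. (\<forall>\<^sub>F t in nhds 0. \<theta> t \<in> vertex_angle \<sigma> n (c t) i) \<and>
      (\<theta> has_real_derivative \<alpha>' i) (at 0)) \<longleftrightarrow> Y i - Y (prv n i) = - (\<sigma> * \<alpha>' i) *\<^sub>R v i"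
    if c: "deformation_path n v v' c" and i: "i < n" for c i
  proof -
    have ni: "nxt n i < n" and pi: "prv n i < n" using i nxt_less prv_less by auto
    have c0: "c 0 j = v j" and cH: "c t j \<in> H2"
      and cd: "((\<lambda>t. c t j) has_vector_derivative v' j) (at 0)" if "j < n" for j t
      using c that by (auto simp: deformation_path_def)
    have "lcross (Y i) (c 0 i) = lcross (Y (prv n i)) (c 0 i)"
      using Y(1)[OF i] Y(2)[OF pi] by (simp add: c0 i nxt_prv)
    from angle_derivative_iff[of "\<lambda>t. c t i" "\<lambda>t. c t (nxt n i)" "\<lambda>t. c t (prv n i)" \<sigma> "Y i" "Y (prv n i)",
        OF cH[OF i] cH[OF ni] cH[OF pi] _ _ s _ _ _ this]
    show ?thesis
      using v[OF i] cd[OF i] cd[OF ni] cd[OF pi] Y(1)[OF i] Y(2)[OF i] Y(1)[OF pi]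
      by (simp add: c0 i ni pi vertex_angle_def)
  qed
  \<comment> \<open>A path is needed because \<open>angle_variation\<close> quantifies over all
    paths and would be vacuous without one.\<close>
  obtain c where "deformation_path n v v' c"
    using deformation_path_exists[of n v v'] v(1) def by blast
  with * show ?thesis unfolding angle_variation_def by blast
qed

text \<open>Since \<open>prv n\<close> permutes the indices, cyclic differences sum to 0.\<close>

lemma sum_prv: "(\<Sum>i<n. f (prv n i)) = (\<Sum>i<n. f i)"
  by (rule sum.reindex_bij_witness[of _ "nxt n" "prv n"])
    (auto simp: nxt_prv prv_nxt nxt_less prv_less)

theorem mainTheorem3:
  fixes n :: nat and v :: "nat \<Rightarrow> real^3" and \<sigma> :: real
  assumes "hyperbolic_polygon n v"
    and "\<sigma> \<in> {1, -1}"
  shows "(\<forall>v' \<alpha>'. isometric_deformation n v v' \<and> angle_variation \<sigma> n v v' \<alpha>' \<longrightarrow>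
            (\<Sum>i<n. \<alpha>' i *\<^sub>R v i) = 0) \<and>
         (\<forall>\<alpha>'. (\<Sum>i<n. \<alpha>' i *\<^sub>R v i) = 0 \<and> \<not> (\<exists>g. is_geodesic g \<and> (\<forall>i<n. v i \<in> g)) \<longrightarrow>
            (\<exists>v'. isometric_deformation n v v' \<and> angle_variation \<sigma> n v v' \<alpha>'))"
proof (intro conjI allI impI; elim conjE)
  fix v' \<alpha>'
  assume iso: "isometric_deformation n v v'" and var: "angle_variation \<sigma> n v v' \<alpha>'"
  have "\<exists>Y. lcross Y (v i) = v' i \<and> lcross Y (v (nxt n i)) = v' (nxt n i)" if "i < n" for i
    using edge_Killing_field_exists[of "v i" "v (nxt n i)" "v' i" "v' (nxt n i)"]
      assms(1) iso that nxt_less[OF that]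
    by (simp add: hyperbolic_polygon_def isometric_deformation_def deformation_def)
  then obtain Y where Y: "\<And>i. i < n \<Longrightarrow> lcross (Y i) (v i) = v' i"
      "\<And>i. i < n \<Longrightarrow> lcross (Y i) (v (nxt n i)) = v' (nxt n i)"
    by metis
  have "deformation n v v'" using iso by (simp add: isometric_deformation_def)
  from angle_variation_iff[OF assms this Y] var
  have "(\<Sum>i<n. Y i - Y (prv n i)) = (\<Sum>i<n. - (\<sigma> * \<alpha>' i) *\<^sub>R v i)" by (intro sum.cong) auto
  \<comment> \<open>The left side is a cyclic telescoping sum, so the factor
    \<open>- \<sigma>\<close>, being nonzero, can be cancelled.\<close>
  also have "\<dots> = - \<sigma> *\<^sub>R (\<Sum>i<n. \<alpha>' i *\<^sub>R v i)" by (simp add: scaleR_sum_right sum_negf)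
  finally show "(\<Sum>i<n. \<alpha>' i *\<^sub>R v i) = 0"
    using assms(2) sum_prv[of Y n] by (auto simp: sum_subtractf)
next
  fix \<alpha>' :: "nat \<Rightarrow> real"
  assume sum0: "(\<Sum>i<n. \<alpha>' i *\<^sub>R v i) = 0"
  \<comment> \<open>The partial sums solve the recursion for the fields, starting from the zero
    field on the edge that closes the polygon.\<close>
  define Y where "Y i = - \<sigma> *\<^sub>R (\<Sum>j\<le>i. \<alpha>' j *\<^sub>R v j)" for i
  define v' where "v' i = lcross (Y i) (v i)" for i
  have Ydiff: "Y i - Y (prv n i) = - (\<sigma> * \<alpha>' i) *\<^sub>R v i" if i: "i < n" for i
  proof (cases i)
    case 0
    \<comment> \<open>Only this closing step uses \<open>sum0\<close>: it makes
      \<open>Y (n - 1)\<close> vanish.\<close>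
    have "{..n - 1} = {..<n}" using i by auto
    with 0 i sum0 show ?thesis by (simp add: Y_def prv_eq)
  next
    case (Suc j)
    with i show ?thesis by (simp add: Y_def prv_eq scaleR_add_right)
  qed
  have Ynxt: "lcross (Y i) (v (nxt n i)) = v' (nxt n i)" if i: "i < n" for i
  proof -
    \<comment> \<open>Consecutive fields differ by a rotation about their common vertex, so they
      agree there.\<close>
    have "Y i = Y (nxt n i) + (\<sigma> * \<alpha>' (nxt n i)) *\<^sub>R v (nxt n i)"
      using Ydiff[OF nxt_less[OF i]] by (simp add: prv_nxt i algebra_simps)
    then show ?thesis by (simp add: v'_def lcross_simps)
  qed
  have def: "deformation n v v'"
    by (simp add: deformation_def tangent_def v'_def lor_commute[of _ "lcross _ _"] lor_lcross_same)
  \<comment> \<open>Both ends of the edge move by the same field \<open>Y i\<close>, which is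
    skew.\<close>
  have "lor (v' i) (v (nxt n i)) + lor (v i) (v' (nxt n i)) = 0" if "i < n" for i
    using lor_lcross_swap[of "Y i" "v i" "v (nxt n i)"]
    by (simp add: v'_def[of i] flip: Ynxt[OF that]) (simp add: lor_commute[of "v i" "lcross _ _"])
  with def have "isometric_deformation n v v'" by (simp add: isometric_deformation_def)
  moreover have "angle_variation \<sigma> n v v' \<alpha>'"
    using angle_variation_iff[OF assms def, of Y \<alpha>'] Ydiff Ynxt by (simp add: v'_def[symmetric])
  ultimately show "\<exists>v'. isometric_deformation n v v' \<and> angle_variation \<sigma> n v v' \<alpha>'" by blast
qed

end
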